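(* Let $n,m\ge1$ be integers, let $a<b$ be real numbers, and let $P_0,\dots,P_{n-1},q_0,\dots,q_{m-1}\in C^\infty[a,b]$. Let $T_1(x,y)\theta(x-y)$ and $T_2(x,y)\theta(x-y)$ be the causal Green's functions on $[a,b]$ of the linear differential operators $$\mathcal{O}_1(x,\partial_x)=\partial_x^n+\sum_{k=0}^{n-1}P_k(x)\,\partial_x^k,\qquad \mathcal{O}_2(x,\partial_x)=\partial_x^m+\sum_{k=0}^{m-1}q_k(x)\,\partial_x^k,$$ respectively. Then $T_3(x,y)\theta(x-y)$, where $$T_3(x,y)=\int_y^x dz\,T_2(x,z)\,T_1(z,y),$$ is the causal Green's function of the linear differential operator $\mathcal{O}_3(x,\partial_x)=\mathcal{O}_1(x,\partial_x)\,\mathcal{O}_2(x,\partial_x)$ (composition of operators, $\mathcal{O}_2$ being applied first).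
   Context: Functions are complex-valued functions of a real variable. $\theta$ is the Heaviside step function: $\theta(t)=1$ for $t>0$ and $\theta(t)=0$ for $t<0$ (the value at $0$ is immaterial; take $\theta(0)=1$). Integrals $\int_y^x$ are oriented, so $\int_y^x=-\int_x^y$ when $x<y$. Causal Green's function: for a monic linear differential operator $\mathcal{O}(x,\partial_x)$ of order $N\ge1$ with continuous coefficients on $[a,b]$, its causal Green's function (the Green's function for the boundary condition $\partial_x^i y(a)=0$, $i=0,\dots,N-1$) is the function $G(x,y)=T(x,y)\theta(x-y)$ on $[a,b]\times[a,b]$ where, for each fixed $y\in[a,b]$, $T(\cdot,y)$ is the unique $N$ times continuously differentiable function on $[a,b]$ with $\mathcal{O}(x,\partial_x)T(x,y)=0$, $(\partial_x^iT(x,y))|_{x=y}=0$ for $i=0,\dots,N-2$, and $(\partial_x^{N-1}T(x,y))|_{x=y}=1$. (When the coefficients are in $C^\infty[a,b]$, $T$ is smooth on $[a,b]\times[a,b]$.) *)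

theory Defs
  imports "HOL-Analysis.Analysis"
begin

(* Derivatives are taken within {a..b}, hence one-sided at the two endpoints.  For a < b the values
   on {a..b} of the iterated derivatives depend only on the values of f on {a..b}. *)
definition iter_deriv :: "real \<Rightarrow> real \<Rightarrow> nat \<Rightarrow> (real \<Rightarrow> complex) \<Rightarrow> real \<Rightarrow> complex" where
  "iter_deriv a b k = (\<lambda>g x. vector_derivative g (at x within {a..b})) ^^ k"

definition Ck_on :: "real \<Rightarrow> real \<Rightarrow> nat \<Rightarrow> (real \<Rightarrow> complex) \<Rightarrow> bool" where
  "Ck_on a b N f \<longleftrightarrow>
     (\<forall>k<N. iter_deriv a b k f differentiable_on {a..b}) \<and>
     continuous_on {a..b} (iter_deriv a b N f)"

definition Cinf_on :: "real \<Rightarrow> real \<Rightarrow> (real \<Rightarrow> complex) \<Rightarrow> bool" where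
  "Cinf_on a b f \<longleftrightarrow> (\<forall>N. Ck_on a b N f)"

definition monic_op ::
  "real \<Rightarrow> real \<Rightarrow> nat \<Rightarrow> (nat \<Rightarrow> real \<Rightarrow> complex) \<Rightarrow> (real \<Rightarrow> complex) \<Rightarrow> real \<Rightarrow> complex" where
  "monic_op a b N c f x = iter_deriv a b N f x + (\<Sum>k<N. c k x * iter_deriv a b k f x)"

(* An operator is a map on functions, so that the product of operators is composition.  It only has
   to agree with the differential expression on C^N[a,b], and only at points of [a,b]. *)
definition is_monic_op ::
  "real \<Rightarrow> real \<Rightarrow> nat \<Rightarrow> ((real \<Rightarrow> complex) \<Rightarrow> real \<Rightarrow> complex) \<Rightarrow> bool" where
  "is_monic_op a b N L \<longleftrightarrow>
     (\<exists>c. (\<forall>k<N. continuous_on {a..b} (c k)) \<and>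
          (\<forall>f. Ck_on a b N f \<longrightarrow> (\<forall>x\<in>{a..b}. L f x = monic_op a b N c f x)))"

definition causal_solution ::
  "real \<Rightarrow> real \<Rightarrow> nat \<Rightarrow> ((real \<Rightarrow> complex) \<Rightarrow> real \<Rightarrow> complex) \<Rightarrow> real \<Rightarrow> (real \<Rightarrow> complex) \<Rightarrow> bool" where
  "causal_solution a b N L y f \<longleftrightarrow>
     Ck_on a b N f \<and>
     (\<forall>x\<in>{a..b}. L f x = 0) \<and>
     (\<forall>i. i + 1 < N \<longrightarrow> iter_deriv a b i f y = 0) \<and>
     iter_deriv a b (N - 1) f y = 1"

(* T is the function of the definition of the causal Green's function T(x,y) * theta(x-y), on the
   whole square, including x < y.  Uniqueness is up to the values outside [a,b]. *)
definition causal_kernel ::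
  "real \<Rightarrow> real \<Rightarrow> nat \<Rightarrow> ((real \<Rightarrow> complex) \<Rightarrow> real \<Rightarrow> complex) \<Rightarrow> (real \<Rightarrow> real \<Rightarrow> complex) \<Rightarrow> bool" where
  "causal_kernel a b N L T \<longleftrightarrow>
     1 \<le> N \<and> is_monic_op a b N L \<and>
     (\<forall>y\<in>{a..b}. causal_solution a b N L y (\<lambda>x. T x y) \<and>
        (\<forall>f. causal_solution a b N L y f \<longrightarrow> (\<forall>x\<in>{a..b}. f x = T x y)))"

definition heaviside :: "real \<Rightarrow> complex" where
  "heaviside t = (if t \<ge> 0 then 1 else 0)"

definition causal_green ::
  "real \<Rightarrow> real \<Rightarrow> nat \<Rightarrow> ((real \<Rightarrow> complex) \<Rightarrow> real \<Rightarrow> complex) \<Rightarrow> (real \<Rightarrow> real \<Rightarrow> complex) \<Rightarrow> bool" where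
  "causal_green a b N L G \<longleftrightarrow>
     (\<exists>T. causal_kernel a b N L T \<and>
          (\<forall>x\<in>{a..b}. \<forall>y\<in>{a..b}. G x y = T x y * heaviside (x - y)))"

end

theory Submission
  imports Defs
begin

text \<open>
The reason is the factorisation of the initial value problem. For fixed \<open>y\<close>, let
\<open>g = T\<^sub>1(\<cdot>, y)\<close> and \<open>u(x) = \<integral>\<^sub>y\<^sup>x T\<^sub>2(x, z) g(z) dz\<close>. By Duhamel's principle, \<open>u\<close> is the
solution of \<open>O\<^sub>2 u = g\<close> all of whose derivatives of order less than \<open>m\<close> vanish at \<open>y\<close>
(lemma \<open>duhamel_integral\<close>). Hence \<open>O\<^sub>1 O\<^sub>2 u = O\<^sub>1 g = 0\<close>. Solving \<open>O\<^sub>2 u = g\<close> for the derivative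
of order \<open>m\<close> and differentiating \<open>i\<close> times expresses \<open>u\<^bsup>(m + i)\<^esup>\<close> as \<open>g\<^bsup>(i)\<^esup>\<close> minus terms that
contain only derivatives of \<open>u\<close> of lower order. This shows that \<open>u\<close> is \<open>n + m\<close> times continuously
differentiable, and, since the lower derivatives vanish at \<open>y\<close>, that \<open>u\<^bsup>(m + i)\<^esup>(y) = g\<^bsup>(i)\<^esup>(y)\<close>
for \<open>i < n\<close>: the initial data of \<open>g\<close>, shifted by \<open>m\<close> places, are exactly those required of a
causal Green's function of order \<open>n + m\<close>.

The analytic input is one energy estimate (\<open>energy_bounded_by_initial_energy\<close>): for a solution of a
homogeneous equation of order \<open>N\<close>, the sum of the squared norms of the first \<open>N\<close> derivatives at one
point controls this sum at every other point, with a constant that depends on the equation only. It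
is used twice. Applied to the difference of two causal solutions at the same \<open>y\<close>, it gives their
uniqueness. Applied to \<open>T\<^sub>2(\<cdot>, z) - T\<^sub>2(\<cdot>, z')\<close>, it gives continuity of \<open>T\<^sub>2\<close> and its
\<open>x\<close>-derivatives jointly in both variables, which is what differentiation under the integral sign
requires.

Separately, \<open>O\<^sub>1 O\<^sub>2\<close> must be recognised as a monic operator of order \<open>n + m\<close> with continuous
coefficients; this is an iteration of the product rule (\<open>is_monic_op_comp\<close>).
\<close>

section \<open>Iterated derivatives on a compact interval\<close>

lemma iter_deriv_0 [simp]: "iter_deriv a b 0 f = f"
  by (simp add: iter_deriv_def)

lemma iter_deriv_Suc:
  "iter_deriv a b (Suc k) f = (\<lambda>x. vector_derivative (iter_deriv a b k f) (at x within {a..b}))"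
  by (simp add: iter_deriv_def)

lemma iter_deriv_add: "iter_deriv a b (j + k) f = iter_deriv a b j (iter_deriv a b k f)"
  by (simp add: iter_deriv_def funpow_add)

lemma Ck_on_mono: "Ck_on a b N f \<Longrightarrow> M \<le> N \<Longrightarrow> Ck_on a b M f"
  unfolding Ck_on_def
  by (metis differentiable_imp_continuous_on dual_order.strict_trans1 le_neq_implies_less)

lemma continuous_on_iter_deriv:
  "Ck_on a b N f \<Longrightarrow> k \<le> N \<Longrightarrow> continuous_on {a..b} (iter_deriv a b k f)"
  using Ck_on_mono unfolding Ck_on_def by blast

lemma Ck_on_add_iff:
  "Ck_on a b (j + k) f \<longleftrightarrow> Ck_on a b k f \<and> Ck_on a b j (iter_deriv a b k f)" (is "?L \<longleftrightarrow> ?R")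
proof
  assume L: ?L
  then show ?R
    using Ck_on_mono[OF L, of k] by (auto simp: Ck_on_def simp flip: iter_deriv_add)
next
  assume R: ?R
  have "iter_deriv a b i f differentiable_on {a..b}" if "i < j + k" for i
  proof (cases "i < k")
    case True
    with R show ?thesis by (simp add: Ck_on_def)
  next
    case False
    then have "i = (i - k) + k" "i - k < j" using that by auto
    with R show ?thesis by (metis Ck_on_def iter_deriv_add)
  qed
  with R show ?L by (simp add: Ck_on_def iter_deriv_add)
qed

context
  fixes a b :: real
  assumes ab: "a < b"
begin

lemma iter_deriv_has_vector_derivative:
  assumes "Ck_on a b N f" "k < N" "x \<in> {a..b}"
  shows "(iter_deriv a b k f has_vector_derivative iter_deriv a b (Suc k) f x) (at x within {a..b})"
  using assms unfolding Ck_on_def iter_deriv_Suc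
  by (meson differentiable_on_def vector_derivative_works)

text \<open>
Iterated derivatives are defined by repeated application of \<open>vector_derivative\<close>, which says little
before differentiability is known. A candidate sequence \<open>F 0, F 1, \<dots>\<close> in which each member is the
derivative of its predecessor identifies them all at once; the closure properties below, except the
one for products, are obtained by naming such a sequence.
\<close>

lemma Ck_on_if_derivative_chain:
  assumes deriv: "\<And>k x. k < N \<Longrightarrow> x \<in> {a..b} \<Longrightarrow>
      (F k has_vector_derivative F (Suc k) x) (at x within {a..b})"
    and cont: "continuous_on {a..b} (F N)"
    and start: "\<And>x. x \<in> {a..b} \<Longrightarrow> f x = F 0 x"
  shows "Ck_on a b N f" and "\<And>k x. k \<le> N \<Longrightarrow> x \<in> {a..b} \<Longrightarrow> iter_deriv a b k f x = F k x"
proof -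
  have eq: "k \<le> N \<longrightarrow> (\<forall>x\<in>{a..b}. iter_deriv a b k f x = F k x)" for k
  proof (induction k)
    case (Suc k)
    show ?case
    proof (intro impI ballI)
      fix x assume k: "Suc k \<le> N" and x: "x \<in> {a..b}"
      have "(iter_deriv a b k f has_vector_derivative F (Suc k) x) (at x within {a..b})"
        using deriv[of k x] k x Suc.IH
        by (intro has_vector_derivative_transform[OF x, of "iter_deriv a b k f" "F k"]) auto
      then show "iter_deriv a b (Suc k) f x = F (Suc k) x"
        unfolding iter_deriv_Suc by (intro vector_derivative_within_closed_interval ab x)
    qed
  qed (use start in auto)
  then show "\<And>k x. k \<le> N \<Longrightarrow> x \<in> {a..b} \<Longrightarrow> iter_deriv a b k f x = F k x" by blast
  have "(iter_deriv a b k f has_vector_derivative F (Suc k) x) (at x within {a..b})"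
    if "k < N" "x \<in> {a..b}" for k x
    using deriv[OF that] eq[of k] that
    by (intro has_vector_derivative_transform[OF that(2), of "iter_deriv a b k f" "F k"]) auto
  then have "iter_deriv a b k f differentiable_on {a..b}" if "k < N" for k
    using that unfolding differentiable_on_def
    by (meson differentiableI_vector)
  moreover have "continuous_on {a..b} (iter_deriv a b N f)"
    using cont eq[of N] by (metis continuous_on_cong order_refl)
  ultimately show "Ck_on a b N f" by (simp add: Ck_on_def)
qed

lemma
  assumes "\<And>x. x \<in> {a..b} \<Longrightarrow> f x = g x" and "Ck_on a b N g"
  shows Ck_on_cong: "Ck_on a b N f"
    and iter_deriv_cong: "\<And>k x. k \<le> N \<Longrightarrow> x \<in> {a..b} \<Longrightarrow> iter_deriv a b k f x = iter_deriv a b k g x"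
  using Ck_on_if_derivative_chain[of N "\<lambda>k. iter_deriv a b k g" f]
    iter_deriv_has_vector_derivative[OF assms(2)] continuous_on_iter_deriv[OF assms(2)] assms(1)
  by auto

lemma
  assumes "Ck_on a b N f" and "Ck_on a b N g"
  shows Ck_on_plus: "Ck_on a b N (\<lambda>x. f x + g x)"
    and iter_deriv_plus: "\<And>k x. k \<le> N \<Longrightarrow> x \<in> {a..b} \<Longrightarrow>
      iter_deriv a b k (\<lambda>x. f x + g x) x = iter_deriv a b k f x + iter_deriv a b k g x"
proof -
  let ?F = "\<lambda>k x. iter_deriv a b k f x + iter_deriv a b k g x"
  have "(?F k has_vector_derivative ?F (Suc k) x) (at x within {a..b})"
    if "k < N" "x \<in> {a..b}" for k x
    using that by (intro has_vector_derivative_add iter_deriv_has_vector_derivative[OF assms(1)] iter_deriv_has_vector_derivative[OF assms(2)])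
  moreover have "continuous_on {a..b} (?F N)"
    by (intro continuous_on_add continuous_on_iter_deriv[OF assms(1)] continuous_on_iter_deriv[OF assms(2)] order_refl)
  ultimately show "Ck_on a b N (\<lambda>x. f x + g x)"
    and "\<And>k x. k \<le> N \<Longrightarrow> x \<in> {a..b} \<Longrightarrow>
      iter_deriv a b k (\<lambda>x. f x + g x) x = ?F k x"
    using Ck_on_if_derivative_chain[of N ?F "\<lambda>x. f x + g x"] by auto
qed

lemma
  assumes "Ck_on a b N f" and "Ck_on a b N g"
  shows Ck_on_minus: "Ck_on a b N (\<lambda>x. f x - g x)"
    and iter_deriv_minus: "\<And>k x. k \<le> N \<Longrightarrow> x \<in> {a..b} \<Longrightarrow>
      iter_deriv a b k (\<lambda>x. f x - g x) x = iter_deriv a b k f x - iter_deriv a b k g x"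
proof -
  let ?F = "\<lambda>k x. iter_deriv a b k f x - iter_deriv a b k g x"
  have "(?F k has_vector_derivative ?F (Suc k) x) (at x within {a..b})"
    if "k < N" "x \<in> {a..b}" for k x
    using that by (intro has_vector_derivative_diff iter_deriv_has_vector_derivative[OF assms(1)] iter_deriv_has_vector_derivative[OF assms(2)])
  moreover have "continuous_on {a..b} (?F N)"
    by (intro continuous_on_diff continuous_on_iter_deriv[OF assms(1)] continuous_on_iter_deriv[OF assms(2)] order_refl)
  ultimately show "Ck_on a b N (\<lambda>x. f x - g x)"
    and "\<And>k x. k \<le> N \<Longrightarrow> x \<in> {a..b} \<Longrightarrow>
      iter_deriv a b k (\<lambda>x. f x - g x) x = ?F k x"
    using Ck_on_if_derivative_chain[of N ?F "\<lambda>x. f x - g x"] by auto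
qed

lemma
  assumes "\<And>i. i \<in> I \<Longrightarrow> Ck_on a b N (f i)"
  shows Ck_on_sum: "Ck_on a b N (\<lambda>x. \<Sum>i\<in>I. f i x)"
    and iter_deriv_sum: "\<And>k x. k \<le> N \<Longrightarrow> x \<in> {a..b} \<Longrightarrow>
      iter_deriv a b k (\<lambda>x. \<Sum>i\<in>I. f i x) x = (\<Sum>i\<in>I. iter_deriv a b k (f i) x)"
proof -
  let ?F = "\<lambda>k x. \<Sum>i\<in>I. iter_deriv a b k (f i) x"
  have "(?F k has_vector_derivative ?F (Suc k) x) (at x within {a..b})"
    if "k < N" "x \<in> {a..b}" for k x
    using that by (intro has_vector_derivative_sum iter_deriv_has_vector_derivative[OF assms])
  moreover have "continuous_on {a..b} (?F N)"
    by (intro continuous_on_sum continuous_on_iter_deriv[OF assms] order_refl)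
  ultimately show "Ck_on a b N (\<lambda>x. \<Sum>i\<in>I. f i x)"
    and "\<And>k x. k \<le> N \<Longrightarrow> x \<in> {a..b} \<Longrightarrow>
      iter_deriv a b k (\<lambda>x. \<Sum>i\<in>I. f i x) x = ?F k x"
    using Ck_on_if_derivative_chain[of N ?F "\<lambda>x. \<Sum>i\<in>I. f i x"] by auto
qed

lemma
  assumes f: "\<And>x. x \<in> {a..b} \<Longrightarrow> (f has_vector_derivative f' x) (at x within {a..b})"
    and f': "Ck_on a b N f'"
  shows Ck_on_SucI: "Ck_on a b (Suc N) f"
    and iter_deriv_Suc_eq: "\<And>k x. k \<le> N \<Longrightarrow> x \<in> {a..b} \<Longrightarrow>
      iter_deriv a b (Suc k) f x = iter_deriv a b k f' x"
proof -
  define F where "F k = (case k of 0 \<Rightarrow> f | Suc k \<Rightarrow> iter_deriv a b k f')" for k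
  have "(F k has_vector_derivative F (Suc k) x) (at x within {a..b})"
    if "k < Suc N" "x \<in> {a..b}" for k x
    using that f iter_deriv_has_vector_derivative[OF f'] by (cases k) (auto simp: F_def)
  moreover have "continuous_on {a..b} (F (Suc N))"
    using continuous_on_iter_deriv[OF f'] by (simp add: F_def)
  ultimately show "Ck_on a b (Suc N) f"
    and "\<And>k x. k \<le> N \<Longrightarrow> x \<in> {a..b} \<Longrightarrow> iter_deriv a b (Suc k) f x = iter_deriv a b k f' x"
    using Ck_on_if_derivative_chain[of "Suc N" F f] by (auto simp: F_def)
qed

lemma Ck_on_derivative:
  assumes "Ck_on a b (Suc N) f"
  shows "Ck_on a b N (iter_deriv a b 1 f)"
  using assms Ck_on_add_iff[of a b N 1 f] by simp

lemma product_rule: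
  assumes f: "Ck_on a b (Suc N) f" and g: "Ck_on a b (Suc N) g" and "x \<in> {a..b}"
  shows "((\<lambda>x. f x * g x) has_vector_derivative
      iter_deriv a b 1 f x * g x + f x * iter_deriv a b 1 g x) (at x within {a..b})"
  using has_vector_derivative_mult[OF iter_deriv_has_vector_derivative[OF f, of 0 x]
      iter_deriv_has_vector_derivative[OF g, of 0 x]] assms(3)
  by (simp add: add.commute)

lemma Ck_on_mult:
  "Ck_on a b N f \<Longrightarrow> Ck_on a b N g \<Longrightarrow> Ck_on a b N (\<lambda>x. f x * g x)"
proof (induction N arbitrary: f g)
  case 0
  then show ?case by (auto simp: Ck_on_def intro: continuous_on_mult)
next
  case (Suc N)
  show ?case
    by (rule Ck_on_SucI[OF product_rule[OF Suc.prems]])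
      (use Suc.prems Ck_on_mono[of a b "Suc N" _ N] Ck_on_derivative
        in \<open>auto intro!: Ck_on_plus Suc.IH\<close>)
qed

text \<open>
By the Leibniz formula every term of the derivative of order \<open>i\<close> of \<open>p f\<close> contains a factor
\<open>f\<^bsup>(j)\<^esup>(y)\<close> with \<open>j \<le> i\<close>.
\<close>

lemma iter_deriv_mult_eq_0:
  "Ck_on a b i p \<Longrightarrow> Ck_on a b i f \<Longrightarrow> y \<in> {a..b} \<Longrightarrow>
   (\<And>j. j \<le> i \<Longrightarrow> iter_deriv a b j f y = 0) \<Longrightarrow> iter_deriv a b i (\<lambda>x. p x * f x) y = 0"
proof (induction i arbitrary: p f)
  case 0
  then show ?case by simp
next
  case (Suc i)
  note p = Suc.prems(1) and f = Suc.prems(2) and y = Suc.prems(3)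
  have p0: "Ck_on a b i p" and f0: "Ck_on a b i f"
    using p f Ck_on_mono by (meson le_SucI order_refl)+
  note p1 = Ck_on_derivative[OF p] and f1 = Ck_on_derivative[OF f]
  have "iter_deriv a b (Suc i) (\<lambda>x. p x * f x) y
      = iter_deriv a b i (\<lambda>x. iter_deriv a b 1 p x * f x + p x * iter_deriv a b 1 f x) y"
    by (rule iter_deriv_Suc_eq[OF product_rule[OF p f] _ order_refl y])
      (assumption | intro Ck_on_plus Ck_on_mult p0 f0 p1 f1)+
  also have "\<dots> = iter_deriv a b i (\<lambda>x. iter_deriv a b 1 p x * f x) y
      + iter_deriv a b i (\<lambda>x. p x * iter_deriv a b 1 f x) y"
    by (rule iter_deriv_plus[OF _ _ order_refl y]) (intro Ck_on_mult p0 f0 p1 f1)+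
  also have "iter_deriv a b i (\<lambda>x. iter_deriv a b 1 p x * f x) y = 0"
    using Suc.prems(4) by (intro Suc.IH p1 f0 y) auto
  also have "iter_deriv a b i (\<lambda>x. p x * iter_deriv a b 1 f x) y = 0"
    using Suc.prems(4)[of "Suc _"] by (intro Suc.IH p0 f1 y) (auto simp flip: iter_deriv_add)
  finally show ?case by simp
qed

section \<open>Energy estimate and uniqueness\<close>

lemma monic_op_minus:
  assumes "Ck_on a b N f" and "Ck_on a b N g" and "t \<in> {a..b}"
  shows "monic_op a b N c (\<lambda>x. f x - g x) t = monic_op a b N c f t - monic_op a b N c g t"
  using assms(3)
  by (simp add: monic_op_def iter_deriv_minus[OF assms(1,2)] right_diff_distrib sum_subtractf)

text \<open>
Gronwall's argument. The energy \<open>E = \<Sum>k<N. \<bar>f\<^bsup>(k)\<^esup>\<bar>\<^sup>2\<close> satisfies \<open>\<bar>E'\<bar> \<le> K E\<close>, since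
\<open>f\<^bsup>(N)\<^esup>\<close> is a bounded combination of the lower derivatives. Therefore \<open>e\<^bsup>-Kt\<^esup> E\<close> decreases and
\<open>e\<^bsup>Kt\<^esup> E\<close> increases, which bounds \<open>E\<close> in both directions from any point. The constant is chosen
before the solution: the joint continuity of a family of solutions below depends on this
uniformity.
\<close>

lemma energy_bounded_by_initial_energy:
  assumes cont: "\<And>k. k < N \<Longrightarrow> continuous_on {a..b} (c k)"
  shows "\<exists>C. \<forall>f. Ck_on a b N f \<and> (\<forall>t\<in>{a..b}. monic_op a b N c f t = 0) \<longrightarrow>
    (\<forall>x\<in>{a..b}. \<forall>x0\<in>{a..b}. (\<Sum>k<N. (norm (iter_deriv a b k f x))\<^sup>2)
      \<le> C * (\<Sum>k<N. (norm (iter_deriv a b k f x0))\<^sup>2))"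
proof -
  have "\<exists>M. \<forall>k<N. \<forall>t\<in>{a..b}. norm (c k t) \<le> M"
  proof -
    have "bounded (\<Union>k<N. c k ` {a..b})"
      using cont by (auto intro!: compact_imp_bounded compact_continuous_image)
    then show ?thesis by (force simp: bounded_iff)
  qed
  then obtain M where M: "\<And>k t. k < N \<Longrightarrow> t \<in> {a..b} \<Longrightarrow> norm (c k t) \<le> M" by blast
  \<comment> \<open>The derivative of \<open>\<bar>f\<^bsup>(k)\<^esup>\<bar>\<^sup>2\<close> is at most \<open>\<bar>f\<^bsup>(k)\<^esup>\<bar>\<^sup>2 + \<bar>f\<^bsup>(k + 1)\<^esup>\<bar>\<^sup>2\<close>. Summed over
    \<open>k\<close>, this is at most \<open>2 E\<close> plus the term of order \<open>N\<close>, which the equation bounds by \<open>M\<^sup>2 N E\<close>.\<close>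
  define K where "K = 2 + M\<^sup>2 * N"
  have K0: "K \<ge> 0" by (simp add: K_def)
  have main: "(\<Sum>k<N. (norm (iter_deriv a b k f x))\<^sup>2)
      \<le> exp (K * (b - a)) * (\<Sum>k<N. (norm (iter_deriv a b k f x0))\<^sup>2)"
    if f: "Ck_on a b N f" and sol: "\<And>t. t \<in> {a..b} \<Longrightarrow> monic_op a b N c f t = 0"
      and x: "x \<in> {a..b}" and x0: "x0 \<in> {a..b}" for f x x0
  proof -
    define E where "E t = (\<Sum>k<N. (norm (iter_deriv a b k f t))\<^sup>2)" for t
    define E' where
      "E' t = (\<Sum>k<N. 2 * (iter_deriv a b k f t \<bullet> iter_deriv a b (Suc k) f t))" for t
    have E_nonneg: "E t \<ge> 0" for t by (simp add: E_def sum_nonneg)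
    have deriv: "(E has_real_derivative E' t) (at t within {a..b})" if t: "t \<in> {a..b}" for t
    proof -
      have "((\<lambda>t. iter_deriv a b k f t \<bullet> iter_deriv a b k f t) has_real_derivative
          2 * (iter_deriv a b k f t \<bullet> iter_deriv a b (Suc k) f t)) (at t within {a..b})"
        if "k < N" for k
      proof -
        have hd: "(iter_deriv a b k f has_derivative (\<lambda>h. h *\<^sub>R iter_deriv a b (Suc k) f t))
            (at t within {a..b})"
          using iter_deriv_has_vector_derivative[OF f that t] by (simp add: has_vector_derivative_def)
        show ?thesis
          unfolding has_field_derivative_def
          by (rule has_derivative_eq_rhs[OF has_derivative_inner[OF hd hd]])
            (auto simp: inner_commute algebra_simps)
      qed
      then show ?thesis
        unfolding E_def[abs_def] E'_def power2_norm_eq_inner by (intro DERIV_sum) auto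
    qed
    have top: "(norm (iter_deriv a b N f t))\<^sup>2 \<le> M\<^sup>2 * N * E t" if t: "t \<in> {a..b}" for t
    proof -
      have "norm (iter_deriv a b N f t) = norm (\<Sum>k<N. c k t * iter_deriv a b k f t)"
        using sol[OF t] unfolding monic_op_def by (metis add_eq_0_iff2 norm_minus_cancel)
      also have "\<dots> \<le> (\<Sum>k<N. M * norm (iter_deriv a b k f t))"
        by (rule sum_norm_le) (auto simp: norm_mult intro!: mult_right_mono M t)
      finally have "(norm (iter_deriv a b N f t))\<^sup>2 \<le> (\<Sum>k<N. M * norm (iter_deriv a b k f t))\<^sup>2"
        by (simp add: power_mono)
      also have "\<dots> \<le> (\<Sum>k<N. (M * norm (iter_deriv a b k f t))\<^sup>2) * card {..<N}"
        by (rule sum_squared_le_sum_of_squares)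
      also have "\<dots> = M\<^sup>2 * N * E t"
        by (simp add: E_def power_mult_distrib sum_distrib_left algebra_simps)
      finally show ?thesis .
    qed
    have bound: "\<bar>E' t\<bar> \<le> K * E t" if t: "t \<in> {a..b}" for t
    proof -
      have "\<bar>E' t\<bar> \<le> (\<Sum>k<N. \<bar>2 * (iter_deriv a b k f t \<bullet> iter_deriv a b (Suc k) f t)\<bar>)"
        unfolding E'_def by (rule sum_abs)
      also have "\<dots> \<le> (\<Sum>k<N. (norm (iter_deriv a b k f t))\<^sup>2 + (norm (iter_deriv a b (Suc k) f t))\<^sup>2)"
      proof (rule sum_mono)
        fix k
        have "\<bar>2 * (u \<bullet> v)\<bar> \<le> (norm u)\<^sup>2 + (norm v)\<^sup>2" for u v :: complex
          using Cauchy_Schwarz_ineq2[of u v] sum_squares_bound[of "norm u" "norm v"]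
          by (simp add: abs_mult)
        then show "\<bar>2 * (iter_deriv a b k f t \<bullet> iter_deriv a b (Suc k) f t)\<bar>
          \<le> (norm (iter_deriv a b k f t))\<^sup>2 + (norm (iter_deriv a b (Suc k) f t))\<^sup>2" .
      qed
      also have "\<dots> = E t + (\<Sum>k<N. (norm (iter_deriv a b (Suc k) f t))\<^sup>2)"
        by (simp add: E_def sum.distrib)
      also have "(\<Sum>k<N. (norm (iter_deriv a b (Suc k) f t))\<^sup>2) \<le> E t + (norm (iter_deriv a b N f t))\<^sup>2"
        using sum.lessThan_Suc_shift[of "\<lambda>k. (norm (iter_deriv a b k f t))\<^sup>2" N]
          sum.lessThan_Suc[of "\<lambda>k. (norm (iter_deriv a b k f t))\<^sup>2" N]
          zero_le_power2[of "norm (iter_deriv a b 0 f t)"]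
        unfolding E_def by linarith
      also have "E t + (E t + (norm (iter_deriv a b N f t))\<^sup>2) \<le> K * E t"
        using top[OF t] by (simp add: K_def algebra_simps)
      finally show ?thesis by simp
    qed
    \<comment> \<open>Forward and backward estimates together: \<open>s = 1\<close> says that
      \<open>e\<^bsup>Kt\<^esup> E\<close> increases, \<open>s = -1\<close> that
      \<open>e\<^bsup>-Kt\<^esup> E\<close> decreases.\<close>
    have mono: "s * exp (s * K * u) * E u \<le> s * exp (s * K * v) * E v"
      if s: "s = 1 \<or> s = - 1" and "u \<le> v" "u \<in> {a..b}" "v \<in> {a..b}" for s u v :: real
    proof -
      have d: "((\<lambda>t. s * exp (s * K * t) * E t) has_real_derivative
          exp (s * K * t) * (K * E t + s * E' t)) (at t within {a..b})" if "t \<in> {a..b}" for t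
        by (rule derivative_eq_intros deriv that refl | use s in \<open>force simp: algebra_simps\<close>)+
      show ?thesis
      proof (rule DERIV_nonneg_imp_increasing_open[OF \<open>u \<le> v\<close>])
        fix t assume "u < t" "t < v"
        then have t: "t \<in> {a..b}" "at t within {a..b} = at t"
          using that by (auto simp: at_within_Icc_at)
        have "K * E t + s * E' t \<ge> 0" using bound[OF t(1)] s by auto
        then show "\<exists>y. ((\<lambda>t. s * exp (s * K * t) * E t) has_real_derivative y) (at t) \<and> 0 \<le> y"
          using d[OF t(1)] unfolding t(2) by (intro exI conjI) (assumption, simp)
      next
        show "continuous_on {u..v} (\<lambda>t. s * exp (s * K * t) * E t)"
          using that by (intro continuous_on_subset[OF DERIV_continuous_on[OF d]]) auto
      qed
    qed
    have "E x \<le> exp (K * \<bar>x - x0\<bar>) * E x0"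
    proof (cases "x0 \<le> x")
      case True
      from mono[of "-1" x0 x] True x x0 have "exp (- (K * x)) * E x \<le> exp (- (K * x0)) * E x0" by simp
      then have "exp (K * x) * (exp (- (K * x)) * E x) \<le> exp (K * x) * (exp (- (K * x0)) * E x0)"
        by (rule mult_left_mono) simp
      with True show ?thesis by (simp add: mult.assoc[symmetric] right_diff_distrib flip: exp_add)
    next
      case False
      from mono[of 1 x x0] False x x0 have "exp (K * x) * E x \<le> exp (K * x0) * E x0" by simp
      then have "exp (- (K * x)) * (exp (K * x) * E x) \<le> exp (- (K * x)) * (exp (K * x0) * E x0)"
        by (rule mult_left_mono) simp
      with False show ?thesis by (simp add: mult.assoc[symmetric] right_diff_distrib flip: exp_add)
    qed
    also have "\<dots> \<le> exp (K * (b - a)) * E x0"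
      using x x0 K0 E_nonneg by (intro mult_right_mono) (auto intro!: mult_left_mono)
    finally show ?thesis by (simp add: E_def)
  qed
  show ?thesis
    using main by blast
qed

text \<open>
The difference of two causal solutions has zero energy at \<open>y\<close>, hence everywhere.
\<close>

lemma causal_solution_unique:
  assumes N: "1 \<le> N" and L: "is_monic_op a b N L" and y: "y \<in> {a..b}"
    and f: "causal_solution a b N L y f" and g: "causal_solution a b N L y g" and x: "x \<in> {a..b}"
  shows "f x = g x"
proof -
  obtain c where c: "\<And>k. k < N \<Longrightarrow> continuous_on {a..b} (c k)"
    and Lc: "\<And>f x. Ck_on a b N f \<Longrightarrow> x \<in> {a..b} \<Longrightarrow> L f x = monic_op a b N c f x"
    using L unfolding is_monic_op_def by blast
  obtain C where C: "\<And>f x x0. Ck_on a b N f \<Longrightarrow> (\<And>t. t \<in> {a..b} \<Longrightarrow> monic_op a b N c f t = 0) \<Longrightarrow>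
      x \<in> {a..b} \<Longrightarrow> x0 \<in> {a..b} \<Longrightarrow>
      (\<Sum>k<N. (norm (iter_deriv a b k f x))\<^sup>2) \<le> C * (\<Sum>k<N. (norm (iter_deriv a b k f x0))\<^sup>2)"
    using energy_bounded_by_initial_energy[of _ c] c by meson
  have fN: "Ck_on a b N f" and gN: "Ck_on a b N g"
    using f g by (auto simp: causal_solution_def)
  define w where "w = (\<lambda>x. f x - g x)"
  have w: "iter_deriv a b k w t = iter_deriv a b k f t - iter_deriv a b k g t"
    if "k \<le> N" "t \<in> {a..b}" for k t
    unfolding w_def by (rule iter_deriv_minus[OF fN gN that])
  have sol: "monic_op a b N c w t = 0" if t: "t \<in> {a..b}" for t
    using f g t Lc[OF fN t] Lc[OF gN t] monic_op_minus[OF fN gN t]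
    by (simp add: causal_solution_def w_def)
  have "iter_deriv a b k w y = 0" if "k < N" for k
  proof (cases "k + 1 < N")
    case True
    then show ?thesis using f g w[of k y] y by (auto simp: causal_solution_def)
  next
    case False
    with that have "k = N - 1" by simp
    then show ?thesis using f g w[of k y] y by (auto simp: causal_solution_def)
  qed
  then have "(\<Sum>k<N. (norm (iter_deriv a b k w x))\<^sup>2) \<le> 0"
    using C[of w x y, OF _ sol x y] Ck_on_minus[OF fN gN] by (simp add: w_def)
  moreover have "(norm (w x))\<^sup>2 \<le> (\<Sum>k<N. (norm (iter_deriv a b k w x))\<^sup>2)"
    using member_le_sum[of 0 "{..<N}" "\<lambda>k. (norm (iter_deriv a b k w x))\<^sup>2"] N by simp
  ultimately have "(norm (w x))\<^sup>2 \<le> 0" by linarith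
  then show ?thesis by (simp add: w_def)
qed

section \<open>Duhamel's principle\<close>

text \<open>
Continuity in \<open>z\<close> comes from the initial data \<open>d\<close> being the same at every base point. The energy of \<open>T(\<cdot>, z) - T(\<cdot>, z\<^sub>0)\<close> may be measured at \<open>x = z\<close>, where the
first function has derivatives \<open>d k\<close>, the derivatives of the second at its own base point \<open>z\<^sub>0\<close>.
So this energy tends to \<open>0\<close> as \<open>z\<close> tends to \<open>z\<^sub>0\<close>, merely because \<open>T(\<cdot>, z\<^sub>0)\<close> and its
derivatives are continuous; the energy estimate makes the convergence uniform in \<open>x\<close>. The derivative
of order \<open>m\<close> is then continuous by the equation.
\<close>

lemma solution_family_jointly_continuous:
  fixes T :: "real \<Rightarrow> real \<Rightarrow> complex"
  assumes c: "\<And>k. k < m \<Longrightarrow> continuous_on {a..b} (c k)"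
    and Ck: "\<And>z. z \<in> {a..b} \<Longrightarrow> Ck_on a b m (\<lambda>x. T x z)"
    and sol: "\<And>x z. x \<in> {a..b} \<Longrightarrow> z \<in> {a..b} \<Longrightarrow> monic_op a b m c (\<lambda>x. T x z) x = 0"
    and diag: "\<And>k z. k < m \<Longrightarrow> z \<in> {a..b} \<Longrightarrow> iter_deriv a b k (\<lambda>x. T x z) z = d k"
    and "k \<le> m"
  shows "continuous_on ({a..b} \<times> {a..b}) (\<lambda>(x, z). iter_deriv a b k (\<lambda>x. T x z) x)"
proof -
  define J where "J k x z = iter_deriv a b k (\<lambda>x. T x z) x" for k x z
  obtain C where C: "\<And>f x x0. Ck_on a b m f \<Longrightarrow>
      (\<And>t. t \<in> {a..b} \<Longrightarrow> monic_op a b m c f t = 0) \<Longrightarrow> x \<in> {a..b} \<Longrightarrow> x0 \<in> {a..b} \<Longrightarrow>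
      (\<Sum>k<m. (norm (iter_deriv a b k f x))\<^sup>2) \<le> C * (\<Sum>k<m. (norm (iter_deriv a b k f x0))\<^sup>2)"
    using energy_bounded_by_initial_energy[of _ c] c by meson
  have lower: "continuous_on ({a..b} \<times> {a..b}) (\<lambda>(x, z). J k x z)" if k: "k < m" for k
    unfolding continuous_on_eq_continuous_within
  proof
    fix p assume p: "p \<in> {a..b} \<times> {a..b}"
    obtain x0 z0 where p_eq: "p = (x0, z0)" and x0: "x0 \<in> {a..b}" and z0: "z0 \<in> {a..b}"
      using p by auto
    \<comment> \<open>The energy of \<open>T(\<cdot>, z) - T(\<cdot>, z\<^sub>0)\<close> at
      \<open>z\<close>, written through \<open>d\<close> so that its dependence on
      \<open>z\<close> is visibly continuous.\<close>
    define e where "e z = (\<Sum>k<m. (norm (d k - J k z z0))\<^sup>2)" for z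
    define G where "G = (\<lambda>(x, z). sqrt (C * e z) + norm (J k x z0 - J k x0 z0))"
    have J_cont: "continuous_on {a..b} (\<lambda>x. J k x z0)" if "k < m" for k
      using continuous_on_iter_deriv[OF Ck[OF z0], of k] that by (simp add: J_def)
    have "continuous_on {a..b} e"
      unfolding e_def[abs_def] by (intro continuous_intros J_cont) auto
    then have e_cont: "continuous_on ({a..b} \<times> {a..b}) (\<lambda>p. e (snd p))"
      by (rule continuous_on_compose2) (auto intro: continuous_intros)
    have "continuous_on ({a..b} \<times> {a..b}) (\<lambda>p. J k (fst p) z0)"
      by (rule continuous_on_compose2[OF J_cont[OF k]]) (auto intro: continuous_intros)
    then have "continuous_on ({a..b} \<times> {a..b}) G"
      unfolding G_def split_beta by (intro continuous_intros e_cont)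
    moreover have "G p = 0"
      using diag[OF _ z0] by (simp add: G_def p_eq e_def J_def)
    ultimately have G_lim: "(G \<longlongrightarrow> 0) (at p within {a..b} \<times> {a..b})"
      using p by (metis continuous_on_def)
    have "norm (J k x z - J k x0 z0) \<le> G (x, z)" if x: "x \<in> {a..b}" and z: "z \<in> {a..b}" for x z
    proof -
      define w where "w = (\<lambda>x. T x z - T x z0)"
      have w: "iter_deriv a b i w t = J i t z - J i t z0" if "i \<le> m" "t \<in> {a..b}" for i t
        unfolding w_def J_def by (rule iter_deriv_minus[OF Ck[OF z] Ck[OF z0] that])
      have sol_w: "monic_op a b m c w t = 0" if "t \<in> {a..b}" for t
        using monic_op_minus[OF Ck[OF z] Ck[OF z0] that] that sol z z0 by (simp add: w_def)
      have "(norm (J k x z - J k x z0))\<^sup>2 \<le> (\<Sum>i<m. (norm (iter_deriv a b i w x))\<^sup>2)"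
        using member_le_sum[of k "{..<m}" "\<lambda>k. (norm (iter_deriv a b k w x))\<^sup>2"] k x by (simp add: w)
      also have "\<dots> \<le> C * (\<Sum>i<m. (norm (iter_deriv a b i w z))\<^sup>2)"
        using Ck_on_minus[OF Ck[OF z] Ck[OF z0]] by (intro C sol_w x z) (simp add: w_def)
      also have "(\<Sum>i<m. (norm (iter_deriv a b i w z))\<^sup>2) = e z"
        using z diag[OF _ z] unfolding e_def by (intro sum.cong) (auto simp: w J_def)
      finally have "norm (J k x z - J k x z0) \<le> sqrt (C * e z)"
        by (rule real_le_rsqrt)
      moreover have "norm (J k x z - J k x0 z0)
          \<le> norm (J k x z - J k x z0) + norm (J k x z0 - J k x0 z0)"
        by (rule norm_diff_triangle_le[OF order_refl order_refl])
      ultimately show ?thesis by (simp add: G_def)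
    qed
    then have "((\<lambda>p. J k (fst p) (snd p) - J k x0 z0) \<longlongrightarrow> 0) (at p within {a..b} \<times> {a..b})"
      by (intro Lim_null_comparison[OF _ G_lim]) (auto simp: eventually_at_filter intro!: always_eventually)
    then show "continuous (at p within {a..b} \<times> {a..b}) (\<lambda>(x, z). J k x z)"
      by (simp add: continuous_within p_eq LIM_zero_iff case_prod_unfold)
  qed
  show ?thesis
  proof (cases "k = m")
    case False
    with lower[of k] \<open>k \<le> m\<close> show ?thesis by (simp add: J_def)
  next
    case True
    have "continuous_on ({a..b} \<times> {a..b}) (\<lambda>p. c k (fst p) * J k (fst p) (snd p))" if "k < m" for k
      using lower[OF that] unfolding split_beta
      by (intro continuous_on_mult continuous_on_compose2[OF c[OF that]]) (auto intro: continuous_intros)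
    then have "continuous_on ({a..b} \<times> {a..b}) (\<lambda>p. - (\<Sum>k<m. c k (fst p) * J k (fst p) (snd p)))"
      by (intro continuous_on_minus continuous_on_sum) auto
    moreover have "J m x z = - (\<Sum>k<m. c k x * J k x z)" if "x \<in> {a..b}" "z \<in> {a..b}" for x z
      using sol[OF that] by (simp add: monic_op_def J_def add_eq_0_iff2)
    ultimately have "continuous_on ({a..b} \<times> {a..b}) (\<lambda>p. J m (fst p) (snd p))"
      by (subst continuous_on_cong[OF refl]) auto
    with True show ?thesis by (simp add: J_def split_beta)
  qed
qed

text \<open>
The two orientations of the integral become one formula when both limits are measured from \<open>a\<close>;
differentiation with respect to a limit then needs no case distinction.
\<close>

lemma oriented_integral_eq:
  fixes f :: "real \<Rightarrow> complex"
  assumes f: "continuous_on {a..b} f" and x: "x \<in> {a..b}" and y: "y \<in> {a..b}"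
  shows "(LBINT z=y..x. f z) = integral {a..x} f - integral {a..y} f"
proof -
  have le: "(LBINT z=s..t. f z) = integral {a..t} f - integral {a..s} f"
    if st: "a \<le> s" "s \<le> t" "t \<le> b" for s t
  proof -
    have "continuous_on {s..t} f" using f st by (auto intro: continuous_on_subset)
    then have "(LBINT z=s..t. f z) = integral {s..t} f"
      using st by (intro interval_integral_eq_integral) (auto simp: set_integrable_def[symmetric] borel_integrable_atLeastAtMost')
    moreover have "integral {a..s} f + integral {s..t} f = integral {a..t} f"
      using st f by (intro Henstock_Kurzweil_Integration.integral_combine)
        (auto intro!: integrable_continuous_real intro: continuous_on_subset)
    ultimately show ?thesis by (simp add: algebra_simps)
  qed
  show ?thesis
  proof (cases "y \<le> x")
    case True
    with le[of y x] x y show ?thesis by simp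
  next
    case False
    with le[of x y] x y show ?thesis
      by (subst interval_integral_endpoints_reverse) simp
  qed
qed

text \<open>
The chain rule along the diagonal for \<open>(u, s) \<mapsto> \<integral>\<^sub>a\<^sup>s K(u, z) dz\<close>, whose partial derivatives are
given by differentiation under the integral sign and by the fundamental theorem of calculus.
\<close>

lemma leibniz_rule_variable_limit:
  fixes K K' :: "real \<Rightarrow> real \<Rightarrow> complex"
  assumes K: "continuous_on ({a..b} \<times> {a..b}) (\<lambda>(x, z). K x z)"
    and K': "continuous_on ({a..b} \<times> {a..b}) (\<lambda>(x, z). K' x z)"
    and deriv: "\<And>x z. x \<in> {a..b} \<Longrightarrow> z \<in> {a..b} \<Longrightarrow>
      ((\<lambda>x. K x z) has_vector_derivative K' x z) (at x within {a..b})"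
    and x: "x \<in> {a..b}" and y: "y \<in> {a..b}"
  shows "((\<lambda>x. LBINT z=y..x. K x z) has_vector_derivative
      (LBINT z=y..x. K' x z) + K x x) (at x within {a..b})"
proof -
  have slice: "continuous_on {a..b} (H u)"
    if "continuous_on ({a..b} \<times> {a..b}) (\<lambda>(x, z). H x z)" "u \<in> {a..b}"
    for H :: "real \<Rightarrow> real \<Rightarrow> complex" and u
  proof -
    have "continuous_on {a..b} (Pair u)" by (intro continuous_intros)
    with that show ?thesis
      using continuous_on_compose2[OF that(1), of "{a..b}" "Pair u"] by force
  qed
  have fixed_limit: "((\<lambda>x. integral {a..s} (K x)) has_vector_derivative integral {a..s} (K' u))
      (at u within {a..b})" if s: "s \<in> {a..b}" and u: "u \<in> {a..b}" for s u
    unfolding interval_cbox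
  proof (rule leibniz_rule_vector_derivative)
    show "K u integrable_on cbox a s" if "u \<in> cbox a b" for u
      using slice[OF K, of u] that s
      by (auto intro!: integrable_continuous_real intro: continuous_on_subset)
    show "continuous_on (cbox a b \<times> cbox a s) (\<lambda>(x, t). K' x t)"
      using s by (auto intro!: continuous_on_subset[OF K'])
  qed (use deriv s u in auto)
  have "((\<lambda>(u, s). integral {a..s} (K u)) has_derivative
      (\<lambda>(tu, ts). tu *\<^sub>R integral {a..x} (K' x) + blinfun_scaleR_left (K x x) ts))
      (at (x, x) within {a..b} \<times> {a..b})"
  proof (rule has_derivative_partialsI[where fy = "\<lambda>u s. blinfun_scaleR_left (K u s)"])
    show "((\<lambda>u. integral {a..x} (K u)) has_derivative (\<lambda>tu. tu *\<^sub>R integral {a..x} (K' x)))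
        (at x within {a..b})"
      using fixed_limit[OF x x] by (simp add: has_vector_derivative_def)
    show "((\<lambda>s. integral {a..s} (K u)) has_derivative blinfun_apply (blinfun_scaleR_left (K u s)))
        (at s within {a..b})" if u: "u \<in> {a..b}" and s: "s \<in> {a..b}" for u s
      using integral_has_vector_derivative[OF slice[OF K u] s] by (simp add: has_vector_derivative_def)
    show "continuous (at (x, x) within {a..b} \<times> {a..b}) (\<lambda>(u, s). blinfun_scaleR_left (K u s))"
    proof -
      have "continuous_on ({a..b} \<times> {a..b}) (\<lambda>(u, s). blinfun_scaleR_left (K u s))"
        using K unfolding split_beta
        by (rule bounded_linear.continuous_on[OF bounded_linear_blinfun_scaleR_left])
      with x show ?thesis by (simp add: continuous_on_eq_continuous_within)
    qed
  qed (use x in auto)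
  then have "((\<lambda>(u, s). integral {a..s} (K u)) has_derivative
      (\<lambda>(tu, ts). tu *\<^sub>R integral {a..x} (K' x) + ts *\<^sub>R K x x))
      (at (x, x) within (\<lambda>t. (t, t)) ` {a..b})"
    by (rule has_derivative_subset[THEN has_derivative_eq_rhs]) auto
  from has_derivative_in_compose[OF _ this, of "\<lambda>t. (t, t)"]
  have "((\<lambda>t. integral {a..t} (K t)) has_derivative
      (\<lambda>t. t *\<^sub>R integral {a..x} (K' x) + t *\<^sub>R K x x)) (at x within {a..b})"
    by (simp add: has_derivative_Pair)
  then have "((\<lambda>t. integral {a..t} (K t)) has_vector_derivative integral {a..x} (K' x) + K x x)
      (at x within {a..b})"
    by (simp add: has_vector_derivative_def scaleR_right_distrib)
  then have "((\<lambda>t. integral {a..t} (K t) - integral {a..y} (K t)) has_vector_derivative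
      (integral {a..x} (K' x) + K x x) - integral {a..y} (K' x)) (at x within {a..b})"
    by (rule has_vector_derivative_diff[OF _ fixed_limit[OF y x]])
  moreover have eq: "(LBINT z=y..t. H t z) = integral {a..t} (H t) - integral {a..y} (H t)"
    if "continuous_on ({a..b} \<times> {a..b}) (\<lambda>(x, z). H x z)" "t \<in> {a..b}"
    for H :: "real \<Rightarrow> real \<Rightarrow> complex" and t
    by (rule oriented_integral_eq[OF slice[OF that] that(2) y])
  ultimately have "((\<lambda>t. integral {a..t} (K t) - integral {a..y} (K t)) has_vector_derivative
      (LBINT z=y..x. K' x z) + K x x) (at x within {a..b})"
    unfolding eq[OF K' x] by (simp add: algebra_simps)
  then show ?thesis
    using eq[OF K] by (rule has_vector_derivative_transform[OF x, rotated])
qed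

text \<open>
Differentiating \<open>\<integral>\<^sub>y\<^sup>x \<partial>\<^sub>x\<^sup>k T(x, z) g(z) dz\<close> produces the next such integral and the boundary term
\<open>(\<partial>\<^sub>x\<^sup>k T)(x, x) g(x)\<close>. The initial data of \<open>T\<close> make it vanish for \<open>k < m - 1\<close> and equal to
\<open>g(x)\<close> for \<open>k = m - 1\<close>. Thus \<open>g\<close> appears exactly once, in the derivative of order \<open>m\<close>, while the
integrals themselves combine to zero under the operator because each \<open>T(\<cdot>, z)\<close> does.
\<close>

lemma duhamel_integral:
  fixes T :: "real \<Rightarrow> real \<Rightarrow> complex" and g :: "real \<Rightarrow> complex"
  assumes m: "1 \<le> m" and q: "\<And>k. k < m \<Longrightarrow> continuous_on {a..b} (q k)"
    and T: "\<And>z. z \<in> {a..b} \<Longrightarrow> causal_solution a b m (monic_op a b m q) z (\<lambda>x. T x z)"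
    and g: "continuous_on {a..b} g" and y: "y \<in> {a..b}"
  defines "u \<equiv> \<lambda>x. LBINT z=y..x. T x z * g z"
  shows "Ck_on a b m u"
    and "\<And>x. x \<in> {a..b} \<Longrightarrow> monic_op a b m q u x = g x"
    and "\<And>k. k < m \<Longrightarrow> iter_deriv a b k u y = 0"
proof -
  define J where "J k x z = iter_deriv a b k (\<lambda>x. T x z) x" for k x z
  define I where "I k x = (LBINT z=y..x. J k x z * g z)" for k x
  define F where "F k x = (if k = m then I m x + g x else I k x)" for k x
  have Ck: "Ck_on a b m (\<lambda>x. T x z)" if "z \<in> {a..b}" for z
    using T[OF that] by (simp add: causal_solution_def)
  have sol: "monic_op a b m q (\<lambda>x. T x z) x = 0" if "x \<in> {a..b}" "z \<in> {a..b}" for x z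
    using T[OF that(2)] that(1) by (simp add: causal_solution_def)
  have diag: "J k z z = (if k = m - 1 then 1 else 0)" if "k < m" "z \<in> {a..b}" for k z
    using T[OF that(2)] that(1) by (simp add: causal_solution_def J_def)
  have J_cont: "continuous_on ({a..b} \<times> {a..b}) (\<lambda>(x, z). J k x z)" if "k \<le> m" for k
    unfolding J_def
    by (rule solution_family_jointly_continuous[OF q Ck sol diag[unfolded J_def] that])
  have Jg_cont: "continuous_on ({a..b} \<times> {a..b}) (\<lambda>(x, z). J k x z * g z)" if "k \<le> m" for k
    using J_cont[OF that] unfolding split_beta
    by (intro continuous_on_mult continuous_on_compose2[OF g]) (auto intro: continuous_intros)
  have Jg_slice: "continuous_on {a..b} (\<lambda>z. J k x z * g z)" if "k \<le> m" "x \<in> {a..b}" for k x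
  proof -
    have "continuous_on {a..b} (Pair x)" by (intro continuous_intros)
    with Jg_cont[OF that(1)] show ?thesis
      using continuous_on_compose2[OF Jg_cont[OF that(1)], of "{a..b}" "Pair x"] that(2) by force
  qed
  have chain: "(F k has_vector_derivative F (Suc k) x) (at x within {a..b})"
    if k: "k < m" and x: "x \<in> {a..b}" for k x
  proof -
    have "((\<lambda>x. J k x z * g z) has_vector_derivative J (Suc k) x z * g z) (at x within {a..b})"
      if "x \<in> {a..b}" "z \<in> {a..b}" for x z
      unfolding J_def
      using iter_deriv_has_vector_derivative[OF Ck[OF that(2)] k that(1)]
      by (rule has_vector_derivative_mult_left)
    then have "(I k has_vector_derivative I (Suc k) x + J k x x * g x) (at x within {a..b})"
      unfolding I_def[abs_def] using k x y
      by (intro leibniz_rule_variable_limit Jg_cont) auto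
    moreover have "I (Suc k) x + J k x x * g x = F (Suc k) x"
      using diag[OF k x] k by (auto simp: F_def)
    moreover have "F k = I k" using k by (auto simp: F_def)
    ultimately show ?thesis by simp
  qed
  have I_top: "I m x = - (\<Sum>k<m. q k x * F k x)" if x: "x \<in> {a..b}" for x
  proof -
    have int: "(\<lambda>z. q k x * (J k x z * g z)) integrable_on {a..t}" if "k < m" "t \<in> {a..b}" for k t
      using that Jg_slice[of k x] x
      by (intro integrable_continuous_real continuous_on_mult_left) (auto intro: continuous_on_subset)
    have Jm: "J m x z = - (\<Sum>k<m. q k x * J k x z)" if "z \<in> {a..b}" for z
      using sol[OF x that] by (simp add: monic_op_def J_def add_eq_0_iff2)
    have "integral {a..t} (\<lambda>z. J m x z * g z) = - (\<Sum>k<m. q k x * integral {a..t} (\<lambda>z. J k x z * g z))"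
      if t: "t \<in> {a..b}" for t
    proof -
      have "integral {a..t} (\<lambda>z. J m x z * g z)
          = integral {a..t} (\<lambda>z. - (\<Sum>k<m. q k x * (J k x z * g z)))"
        using t by (intro integral_cong) (auto simp: Jm sum_distrib_right mult.assoc)
      also have "\<dots> = - (\<Sum>k<m. integral {a..t} (\<lambda>z. q k x * (J k x z * g z)))"
      proof -
        have "integral {a..t} (\<lambda>z. \<Sum>k<m. q k x * (J k x z * g z))
            = (\<Sum>k<m. integral {a..t} (\<lambda>z. q k x * (J k x z * g z)))"
          using int t by (intro integral_sum) auto
        then show ?thesis by simp
      qed
      finally show ?thesis by simp
    qed
    then have "I m x = - (\<Sum>k<m. q k x * I k x)"
      using x y by (simp add: I_def oriented_integral_eq[OF Jg_slice] right_diff_distrib sum_subtractf)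
    then show ?thesis by (simp add: F_def)
  qed
  have "continuous_on {a..b} (F k)" if "k < m" for k
    unfolding continuous_on_eq_continuous_within
    using chain[OF that] by (blast intro: has_vector_derivative_continuous)
  then have "continuous_on {a..b} (\<lambda>x. - (\<Sum>k<m. q k x * F k x) + g x)"
    by (intro continuous_intros q g) auto
  then have F_top: "continuous_on {a..b} (F m)"
    by (rule continuous_on_eq) (simp add: F_def I_top)
  have u: "u x = F 0 x" for x
    using m by (simp add: u_def F_def I_def J_def)
  show "Ck_on a b m u"
    by (rule Ck_on_if_derivative_chain(1)[of m F u]) (auto intro!: chain F_top u)
  have iter: "iter_deriv a b k u x = F k x" if "k \<le> m" "x \<in> {a..b}" for k x
    by (rule Ck_on_if_derivative_chain(2)[of m F u]) (simp_all add: chain F_top u that del: atLeastAtMost_iff)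
  show "monic_op a b m q u x = g x" if x: "x \<in> {a..b}" for x
  proof -
    have "monic_op a b m q u x = F m x + (\<Sum>k<m. q k x * F k x)"
      using x by (simp add: monic_op_def iter)
    also have "F m x = - (\<Sum>k<m. q k x * F k x) + g x"
      using I_top[OF x] by (simp add: F_def[of m])
    finally show ?thesis by simp
  qed
  show "iter_deriv a b k u y = 0" if "k < m" for k
    using that y by (simp add: iter F_def I_def)
qed

section \<open>Regularity and initial data of solutions of an inhomogeneous equation\<close>

text \<open>
Both facts read the equation as \<open>u\<^bsup>(m)\<^esup> = g - \<Sum>k<m. q\<^sub>k u\<^bsup>(k)\<^esup>\<close>. If \<open>u\<close> has \<open>j + m\<close> continuous
derivatives with \<open>j < n\<close>, the right-hand side has \<open>j + 1\<close>, so \<open>u\<close> gains one. Differentiating the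
right-hand side \<open>i\<close> times at a point where the derivatives of \<open>u\<close> of order less than \<open>i + m\<close> vanish
leaves \<open>g\<^bsup>(i)\<^esup>\<close> alone.
\<close>

lemma
  assumes q: "\<And>k. k < m \<Longrightarrow> Cinf_on a b (q k)"
    and u: "Ck_on a b m u" and eq: "\<And>x. x \<in> {a..b} \<Longrightarrow> monic_op a b m q u x = g x"
    and g: "Ck_on a b n g"
  shows Ck_on_of_monic_op_eq: "Ck_on a b (n + m) u"
    and iter_deriv_of_monic_op_eq: "\<And>i y. i \<le> n \<Longrightarrow> y \<in> {a..b} \<Longrightarrow>
      (\<And>l. l < i + m \<Longrightarrow> iter_deriv a b l u y = 0) \<Longrightarrow> iter_deriv a b (i + m) u y = iter_deriv a b i g y"
proof -
  define h where "h x = g x - (\<Sum>k<m. q k x * iter_deriv a b k u x)" for x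
  have top: "iter_deriv a b m u x = h x" if "x \<in> {a..b}" for x
    using eq[OF that] by (simp add: h_def monic_op_def algebra_simps)
  have lower: "Ck_on a b j (\<lambda>x. q k x * iter_deriv a b k u x)"
    if "k < m" "Ck_on a b i u" "j + k \<le> i" for i j k
    using q[OF that(1)] Ck_on_mono[OF that(2,3)]
    by (intro Ck_on_mult) (auto simp: Cinf_on_def Ck_on_add_iff)
  have h: "Ck_on a b j h" if "j \<le> n" "Ck_on a b i u" "j + m \<le> Suc i" for i j
    unfolding h_def[abs_def] using that
    by (intro Ck_on_minus Ck_on_sum Ck_on_mono[OF g] lower[of _ i]) auto
  have "j \<le> n \<longrightarrow> Ck_on a b (j + m) u" for j
  proof (induction j)
    case (Suc j)
    show ?case
    proof
      assume j: "Suc j \<le> n"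
      with Suc.IH have "Ck_on a b (j + m) u" by simp
      then have "Ck_on a b (Suc j) h" using j by (intro h[of _ "j + m"]) auto
      from top this have "Ck_on a b (Suc j) (iter_deriv a b m u)" by (rule Ck_on_cong)
      with u show "Ck_on a b (Suc j + m) u" by (simp only: Ck_on_add_iff)
    qed
  qed (use u in simp)
  then show reg: "Ck_on a b (n + m) u" by simp
  fix i y
  assume i: "i \<le> n" and y: "y \<in> {a..b}" and zero: "\<And>l. l < i + m \<Longrightarrow> iter_deriv a b l u y = 0"
  have lower_i: "Ck_on a b i (\<lambda>x. q k x * iter_deriv a b k u x)" if "k < m" for k
    using lower[OF that reg] i that by simp
  have "iter_deriv a b (i + m) u y = iter_deriv a b i h y"
    using h[OF i reg] i unfolding iter_deriv_add by (intro iter_deriv_cong[OF top _ order_refl y]) auto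
  also have "\<dots> = iter_deriv a b i g y - iter_deriv a b i (\<lambda>x. \<Sum>k<m. q k x * iter_deriv a b k u x) y"
    unfolding h_def[abs_def]
    by (rule iter_deriv_minus[OF Ck_on_mono[OF g i] Ck_on_sum[OF lower_i] order_refl y]) simp
  also have "iter_deriv a b i (\<lambda>x. \<Sum>k<m. q k x * iter_deriv a b k u x) y
      = (\<Sum>k<m. iter_deriv a b i (\<lambda>x. q k x * iter_deriv a b k u x) y)"
    by (rule iter_deriv_sum[OF lower_i order_refl y]) simp
  also have "\<dots> = 0"
  proof (rule sum.neutral, rule ballI)
    fix k assume "k \<in> {..<m}"
    then have k: "k < m" by simp
    have "Ck_on a b (i + k) u" using i k by (intro Ck_on_mono[OF reg]) simp
    then have "Ck_on a b i (iter_deriv a b k u)" by (simp add: Ck_on_add_iff)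
    moreover have "Ck_on a b i (q k)" using q[OF k] by (simp add: Cinf_on_def)
    ultimately show "iter_deriv a b i (\<lambda>x. q k x * iter_deriv a b k u x) y = 0"
      using zero k by (intro iter_deriv_mult_eq_0[OF _ _ y]) (auto simp flip: iter_deriv_add)
  qed
  finally show "iter_deriv a b (i + m) u y = iter_deriv a b i g y" by simp
qed

section \<open>Composition of differential operators\<close>

text \<open>
Since \<open>(c\<^sub>k f\<^bsup>(k)\<^esup>)' = c\<^sub>k' f\<^bsup>(k)\<^esup> + c\<^sub>k f\<^bsup>(k + 1)\<^esup>\<close>, the coefficients of the differentiated
operator are \<open>c\<^sub>k' + c\<^bsub>k - 1\<^esub>\<close>, where the first summand is absent for \<open>k = N\<close> and the second for
\<open>k = 0\<close>.
\<close>

lemma derivative_of_monic_op: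
  assumes c: "\<And>k. k < N \<Longrightarrow> Cinf_on a b (c k)"
  shows "\<exists>c'. (\<forall>k<Suc N. Cinf_on a b (c' k)) \<and>
    (\<forall>f. Ck_on a b (Suc N) f \<longrightarrow> (\<forall>x\<in>{a..b}.
      (monic_op a b N c f has_vector_derivative monic_op a b (Suc N) c' f x) (at x within {a..b})))"
proof -
  define c' where "c' k x = (if k < N then iter_deriv a b 1 (c k) x else 0)
      + (if k = 0 then 0 else c (k - 1) x)" for k x
  have zero: "Ck_on a b j (\<lambda>x. 0)" for j
    using Ck_on_sum[of "{}"] by simp
  have c1: "Ck_on a b j (iter_deriv a b 1 (c k))" if "k < N" for j k
    using c[OF that] by (intro Ck_on_derivative) (auto simp: Cinf_on_def)
  have "Ck_on a b j (c' k)" if "k < Suc N" for j k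
  proof -
    have "Ck_on a b j (\<lambda>x. if k < N then iter_deriv a b 1 (c k) x else 0)"
      using c1 zero by (cases "k < N") simp_all
    moreover have "Ck_on a b j (\<lambda>x. if k = 0 then 0 else c (k - 1) x)"
      using c[of "k - 1"] zero that by (cases k) (auto simp: Cinf_on_def)
    ultimately show ?thesis unfolding c'_def[abs_def] by (rule Ck_on_plus)
  qed
  moreover have "(monic_op a b N c f has_vector_derivative monic_op a b (Suc N) c' f x) (at x within {a..b})"
    if f: "Ck_on a b (Suc N) f" and x: "x \<in> {a..b}" for f x
  proof -
    let ?D = "\<lambda>k. iter_deriv a b k f x"
    have "((\<lambda>x. c k x * iter_deriv a b k f x) has_vector_derivative
        iter_deriv a b 1 (c k) x * ?D k + c k x * ?D (Suc k)) (at x within {a..b})"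
      if k: "k < N" for k
    proof -
      have "Ck_on a b (Suc 0 + k) f" using k by (intro Ck_on_mono[OF f]) simp
      then have "Ck_on a b (Suc 0) (iter_deriv a b k f)" by (simp only: Ck_on_add_iff)
      moreover have "Ck_on a b (Suc 0) (c k)" using c[OF k] by (simp add: Cinf_on_def)
      ultimately show ?thesis
        using product_rule[of 0 "c k" "iter_deriv a b k f" x] x by (simp flip: iter_deriv_add)
    qed
    then have "(monic_op a b N c f has_vector_derivative
        ?D (Suc N) + (\<Sum>k<N. iter_deriv a b 1 (c k) x * ?D k + c k x * ?D (Suc k))) (at x within {a..b})"
      unfolding monic_op_def[abs_def]
      by (intro has_vector_derivative_add has_vector_derivative_sum
          iter_deriv_has_vector_derivative[OF f _ x]) auto
    also have "(\<Sum>k<N. iter_deriv a b 1 (c k) x * ?D k + c k x * ?D (Suc k))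
        = (\<Sum>k<Suc N. c' k x * ?D k)"
    proof -
      have "(\<Sum>k<Suc N. c' k x * ?D k)
          = (\<Sum>k<Suc N. (if k < N then iter_deriv a b 1 (c k) x else 0) * ?D k)
            + (\<Sum>k<Suc N. (if k = 0 then 0 else c (k - 1) x) * ?D k)"
        by (simp only: c'_def distrib_right sum.distrib)
      also have "(\<Sum>k<Suc N. (if k < N then iter_deriv a b 1 (c k) x else 0) * ?D k)
          = (\<Sum>k<N. iter_deriv a b 1 (c k) x * ?D k)" by simp
      also have "(\<Sum>k<Suc N. (if k = 0 then 0 else c (k - 1) x) * ?D k)
          = (\<Sum>k<N. c k x * ?D (Suc k))" by (simp add: sum.lessThan_Suc_shift del: sum.lessThan_Suc)
      finally show ?thesis by (simp add: sum.distrib)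
    qed
    finally show ?thesis by (simp add: monic_op_def[of _ _ "Suc N"])
  qed
  ultimately show ?thesis
    unfolding Cinf_on_def by (intro exI[of _ c'] conjI allI impI ballI)
qed

lemma iter_deriv_of_monic_op:
  assumes q: "\<And>k. k < m \<Longrightarrow> Cinf_on a b (q k)"
  shows "\<exists>c. (\<forall>k<i + m. Cinf_on a b (c k)) \<and>
    (\<forall>f. Ck_on a b (i + m) f \<longrightarrow>
      (\<forall>x\<in>{a..b}. iter_deriv a b i (monic_op a b m q f) x = monic_op a b (i + m) c f x))"
proof (induction i)
  case 0
  then show ?case using q by auto
next
  case (Suc i)
  then obtain c where c_all: "(\<forall>k<i + m. Cinf_on a b (c k)) \<and>
    (\<forall>f. Ck_on a b (i + m) f \<longrightarrow>
      (\<forall>x\<in>{a..b}. iter_deriv a b i (monic_op a b m q f) x = monic_op a b (i + m) c f x))" ..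
  have c: "Cinf_on a b (c k)" if "k < i + m" for k
    using c_all that by simp
  have eq: "iter_deriv a b i (monic_op a b m q f) x = monic_op a b (i + m) c f x"
    if "Ck_on a b (i + m) f" "x \<in> {a..b}" for f x
    using c_all that by simp
  from derivative_of_monic_op[of "i + m" c, OF c]
  obtain c' where c'_all: "(\<forall>k<Suc (i + m). Cinf_on a b (c' k)) \<and>
    (\<forall>f. Ck_on a b (Suc (i + m)) f \<longrightarrow> (\<forall>x\<in>{a..b}.
      (monic_op a b (i + m) c f has_vector_derivative monic_op a b (Suc (i + m)) c' f x)
        (at x within {a..b})))" ..
  have "iter_deriv a b (Suc i) (monic_op a b m q f) x = monic_op a b (Suc (i + m)) c' f x"
    if f: "Ck_on a b (Suc (i + m)) f" and x: "x \<in> {a..b}" for f x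
  proof -
    have f': "Ck_on a b (i + m) f" using f by (rule Ck_on_mono) simp
    have "(iter_deriv a b i (monic_op a b m q f) has_vector_derivative monic_op a b (Suc (i + m)) c' f x)
        (at x within {a..b})"
    proof (rule has_vector_derivative_transform[OF x eq[OF f']])
      show "(monic_op a b (i + m) c f has_vector_derivative monic_op a b (Suc (i + m)) c' f x)
        (at x within {a..b})"
        using c'_all f x by blast
    qed
    then show ?thesis
      unfolding iter_deriv_Suc by (rule vector_derivative_within_closed_interval[OF ab x])
  qed
  with c'_all show ?case by auto
qed

lemma is_monic_op_comp:
  assumes P: "\<And>k. k < n \<Longrightarrow> continuous_on {a..b} (P k)"
    and q: "\<And>k. k < m \<Longrightarrow> Cinf_on a b (q k)"
  shows "is_monic_op a b (n + m) (monic_op a b n P \<circ> monic_op a b m q)"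
proof -
  have "\<exists>c. \<forall>i. (\<forall>k<i + m. Cinf_on a b (c i k)) \<and>
    (\<forall>f. Ck_on a b (i + m) f \<longrightarrow>
      (\<forall>x\<in>{a..b}. iter_deriv a b i (monic_op a b m q f) x = monic_op a b (i + m) (c i) f x))"
    by (rule choice, rule allI, rule iter_deriv_of_monic_op[OF q])
  then obtain c where c_all: "\<forall>i. (\<forall>k<i + m. Cinf_on a b (c i k)) \<and>
    (\<forall>f. Ck_on a b (i + m) f \<longrightarrow>
      (\<forall>x\<in>{a..b}. iter_deriv a b i (monic_op a b m q f) x = monic_op a b (i + m) (c i) f x))" ..
  have c: "Cinf_on a b (c i k)" if "k < i + m" for i k
    using c_all that by simp
  have eq: "iter_deriv a b i (monic_op a b m q f) x = monic_op a b (i + m) (c i) f x"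
    if "Ck_on a b (i + m) f" "x \<in> {a..b}" for i f x
    using c_all that by simp
  \<comment> \<open>Coefficients of \<open>\<partial>\<^sup>i O\<^sub>2\<close>, leading
    coefficient included, padded by zeros to the common length \<open>n + m\<close>.\<close>
  define e where "e i k x = (if k = i + m then 1 else if k < i + m then c i k x else 0)" for i k x
  define d where "d k x = c n k x + (\<Sum>i<n. P i x * e i k x)" for k x
  have c_cont: "continuous_on {a..b} (c i k)" if "k < i + m" for i k
    using c[OF that] continuous_on_iter_deriv[of a b 0 "c i k" 0] by (simp add: Cinf_on_def)
  have "continuous_on {a..b} (e i k)" for i k
    unfolding e_def[abs_def] using c_cont by (cases "k = i + m"; cases "k < i + m") auto
  then have "continuous_on {a..b} (d k)" if "k < n + m" for k
    unfolding d_def[abs_def] using that by (intro continuous_intros P c_cont) auto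
  moreover have "(monic_op a b n P \<circ> monic_op a b m q) f x = monic_op a b (n + m) d f x"
    if f: "Ck_on a b (n + m) f" and x: "x \<in> {a..b}" for f x
  proof -
    let ?D = "\<lambda>k. iter_deriv a b k f x"
    have lower: "iter_deriv a b i (monic_op a b m q f) x = (\<Sum>k<n + m. e i k x * ?D k)"
      if i: "i < n" for i
    proof -
      have "iter_deriv a b i (monic_op a b m q f) x = (\<Sum>k<Suc (i + m). e i k x * ?D k)"
        using eq[of i f x] Ck_on_mono[OF f, of "i + m"] i x by (simp add: monic_op_def e_def)
      also have "\<dots> = (\<Sum>k<n + m. e i k x * ?D k)"
        using i by (intro sum.mono_neutral_left) (auto simp: e_def)
      finally show ?thesis .
    qed
    have "(monic_op a b n P \<circ> monic_op a b m q) f x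
        = monic_op a b (n + m) (c n) f x + (\<Sum>i<n. P i x * (\<Sum>k<n + m. e i k x * ?D k))"
      using eq[OF f x] lower by (simp add: monic_op_def[of a b n P])
    also have "(\<Sum>i<n. P i x * (\<Sum>k<n + m. e i k x * ?D k)) = (\<Sum>k<n + m. (\<Sum>i<n. P i x * e i k x) * ?D k)"
      by (simp add: sum_distrib_left sum_distrib_right mult.assoc) (rule sum.swap)
    finally show ?thesis by (simp add: monic_op_def[of a b "n + m"] d_def distrib_right sum.distrib)
  qed
  ultimately show ?thesis unfolding is_monic_op_def by blast
qed

end

section \<open>The causal Green's function of a product\<close>

theorem theorem2:
  fixes n m :: nat and a b :: real
    and P q :: "nat \<Rightarrow> real \<Rightarrow> complex"
    and T1 T2 T3 :: "real \<Rightarrow> real \<Rightarrow> complex"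
    and L1 L2 L3 :: "(real \<Rightarrow> complex) \<Rightarrow> real \<Rightarrow> complex"
  defines "L1 \<equiv> monic_op a b n P"
    and "L2 \<equiv> monic_op a b m q"
    and "L3 \<equiv> L1 \<circ> L2"
    and "T3 \<equiv> (\<lambda>x y. LBINT z=y..x. T2 x z * T1 z y)"
  assumes "1 \<le> n" and "1 \<le> m" and "a < b"
    and "\<And>k. k < n \<Longrightarrow> Cinf_on a b (P k)"
    and "\<And>k. k < m \<Longrightarrow> Cinf_on a b (q k)"
    and "causal_kernel a b n L1 T1"
    and "causal_kernel a b m L2 T2"
  shows "causal_kernel a b (n + m) L3 T3 \<and>
         causal_green a b (n + m) L3 (\<lambda>x y. T3 x y * heaviside (x - y))"
proof -
  note n = \<open>1 \<le> n\<close> and m = \<open>1 \<le> m\<close> and ab = \<open>a < b\<close>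
  note P = \<open>\<And>k. k < n \<Longrightarrow> Cinf_on a b (P k)\<close> and q = \<open>\<And>k. k < m \<Longrightarrow> Cinf_on a b (q k)\<close>
  have cont: "continuous_on {a..b} f" if "Cinf_on a b f" for f
    using that continuous_on_iter_deriv[of a b 0 f 0] by (simp add: Cinf_on_def)
  have monic: "is_monic_op a b (n + m) L3"
    unfolding L3_def L1_def L2_def by (rule is_monic_op_comp[OF ab cont[OF P] q])
  have T1: "causal_solution a b n (monic_op a b n P) y (\<lambda>x. T1 x y)" if "y \<in> {a..b}" for y
    using that \<open>causal_kernel a b n L1 T1\<close> by (simp add: causal_kernel_def L1_def)
  have T2: "causal_solution a b m (monic_op a b m q) y (\<lambda>x. T2 x y)" if "y \<in> {a..b}" for y
    using that \<open>causal_kernel a b m L2 T2\<close> by (simp add: causal_kernel_def L2_def)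
  have sol: "causal_solution a b (n + m) L3 y (\<lambda>x. T3 x y)" if y: "y \<in> {a..b}" for y
  proof -
    define g where "g z = T1 z y" for z
    define u where "u x = T3 x y" for x
    have g: "Ck_on a b n g" and g_sol: "\<And>x. x \<in> {a..b} \<Longrightarrow> monic_op a b n P g x = 0"
      and g_low: "\<And>i. i + 1 < n \<Longrightarrow> iter_deriv a b i g y = 0"
      and g_top: "iter_deriv a b (n - 1) g y = 1"
      using T1[OF y] by (auto simp: causal_solution_def g_def[abs_def])
    have g_cont: "continuous_on {a..b} g"
      using continuous_on_iter_deriv[OF g, of 0] by simp
    have u_eq: "u = (\<lambda>x. LBINT z=y..x. T2 x z * g z)"
      by (simp add: u_def[abs_def] g_def T3_def)
    note duhamel = duhamel_integral[OF ab m cont[OF q] T2 g_cont y, folded u_eq]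
    note reg = Ck_on_of_monic_op_eq[OF ab q duhamel(1,2) g]
    note step = iter_deriv_of_monic_op_eq[OF ab q duhamel(1,2) g _ y]
    \<comment> \<open>Below order \<open>m\<close> by Duhamel; from there on each derivative at
      \<open>y\<close> equals the one of \<open>g\<close> that lies \<open>m\<close> orders
      lower.\<close>
    have low: "l + 1 < n + m \<longrightarrow> iter_deriv a b l u y = 0" for l
    proof (induction l rule: less_induct)
      case (less l)
      show ?case
      proof (cases "l < m")
        case False
        show ?thesis
        proof
          assume l: "l + 1 < n + m"
          define i where "i = l - m"
          have i: "l = i + m" "i + 1 < n" using False l by (auto simp: i_def)
          have "iter_deriv a b (i + m) u y = iter_deriv a b i g y"
            using i less.IH by (intro step) auto
          then show "iter_deriv a b l u y = 0" using g_low i by simp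
        qed
      qed (use duhamel(3) in auto)
    qed
    have "iter_deriv a b (n - 1 + m) u y = iter_deriv a b (n - 1) g y"
      using low n by (intro step) auto
    then have top: "iter_deriv a b (n + m - 1) u y = 1"
      using g_top n by (simp add: add.commute)
    have "L3 u x = 0" if x: "x \<in> {a..b}" for x
    proof -
      have "iter_deriv a b k (monic_op a b m q u) x = iter_deriv a b k g x" if "k \<le> n" for k
        by (rule iter_deriv_cong[OF ab duhamel(2) g that x])
      then have "L3 u x = monic_op a b n P g x"
        by (simp add: L3_def L1_def L2_def monic_op_def[of a b n P])
      then show ?thesis using g_sol[OF x] by simp
    qed
    with reg low top show ?thesis by (simp add: causal_solution_def u_def[abs_def])
  qed
  have kernel: "causal_kernel a b (n + m) L3 T3"
    unfolding causal_kernel_def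
    using n monic sol causal_solution_unique[OF ab _ monic _ _ sol] by auto
  then show ?thesis by (auto simp: causal_green_def)
qed

end
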